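(* Let $W$ be a fixed wedge in $\mathbb{R}^2$. Let $S$ be a set of $n$ points in $\mathbb{R}^2$ whose pairwise distances are distinct. Then $|\varPhi(S,\mathcal{L}_W)| = O(n)$, where the constant hidden in $O(\cdot)$ depends only on $W$.
   Context: A wedge is a (closed) range in $\mathbb{R}^2$ defined by an angle $\theta\in(0,\pi)$, i.e. the intersection of two halfplanes whose boundary consists of two rays sharing a common initial point. For $p\in\mathbb{R}^2$, $W_p=p+W$ and $\mathcal{L}_W=\{W_p: p\in\mathbb{R}^2\}$. For a finite set $S$ of points and a collection $\mathcal{X}$ of ranges, a candidate pair in $S$ with respect to $\mathcal{X}$ is an (unordered) pair of distinct points of $S$ that is the closest-pair (the pair of minimum Euclidean distance) in $S\cap X$ for some $X\in\mathcal{X}$; $\varPhi(S,\mathcal{X})$ denotes the set of all candidate pairs. *)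

theory Defs
  imports "HOL-Analysis.Analysis"
begin

definition closed_halfplane :: "(real ^ 2) set \<Rightarrow> bool" where
  "closed_halfplane H \<longleftrightarrow> (\<exists>a b. a \<noteq> 0 \<and> H = {x. a \<bullet> x \<le> b})"

definition ray :: "real ^ 2 \<Rightarrow> real ^ 2 \<Rightarrow> (real ^ 2) set" where
  "ray p d = {p + t *\<^sub>R d | t. t \<ge> 0}"

text \<open>The condition on \<open>\<theta>\<close> excludes the degenerate intersections (a halfplane, a line), whose boundary
  also consists of two rays with a common initial point, at angle \<open>\<pi>\<close>. As \<open>W\<close> is convex, the angle
  between the two boundary rays is the interior angle of \<open>W\<close>.\<close>

definition is_wedge :: "(real ^ 2) set \<Rightarrow> bool" where
  "is_wedge W \<longleftrightarrow>
    (\<exists>H1 H2 p d1 d2 \<theta>. closed_halfplane H1 \<and> closed_halfplane H2 \<and> W = H1 \<inter> H2 \<and>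
       frontier W = ray p d1 \<union> ray p d2 \<and>
       norm d1 = 1 \<and> norm d2 = 1 \<and> 0 < \<theta> \<and> \<theta> < pi \<and> d1 \<bullet> d2 = cos \<theta>)"

definition translates :: "(real ^ 2) set \<Rightarrow> (real ^ 2) set set" where
  "translates W = {(+) p ` W | p. True}"

text \<open>Unordered pairs of distinct points are two-element sets.\<close>

definition closest_pair :: "(real ^ 2) set \<Rightarrow> (real ^ 2) set \<Rightarrow> bool" where
  "closest_pair T e \<longleftrightarrow>
    (\<exists>a\<in>T. \<exists>b\<in>T. a \<noteq> b \<and> e = {a, b} \<and> (\<forall>c\<in>T. \<forall>d\<in>T. c \<noteq> d \<longrightarrow> dist a b \<le> dist c d))"

definition candidate_pairs :: "(real ^ 2) set \<Rightarrow> (real ^ 2) set set \<Rightarrow> (real ^ 2) set set" where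
  "candidate_pairs S \<X> = {e. \<exists>X\<in>\<X>. closest_pair (S \<inter> X) e}"

definition distinct_distances :: "(real ^ 2) set \<Rightarrow> bool" where
  "distinct_distances S \<longleftrightarrow>
    (\<forall>a\<in>S. \<forall>b\<in>S. \<forall>c\<in>S. \<forall>d\<in>S. a \<noteq> b \<and> c \<noteq> d \<and> {a, b} \<noteq> {c, d} \<longrightarrow> dist a b \<noteq> dist c d)"

text \<open>Cardinalities of candidate sets are therefore genuine.\<close>

lemma finite_candidate_pairs:
  assumes "finite S"
  shows "finite (candidate_pairs S \<X>)"
proof (rule finite_subset)
  show "candidate_pairs S \<X> \<subseteq> Pow S"
    by (auto simp: candidate_pairs_def closest_pair_def)
qed (use assms in simp)

end

theory Submission imports Defs begin

text \<open>
  The translates of the wedge are the quadrants \<open>\<alpha> \<bullet> x \<le> s\<close>, \<open>\<beta> \<bullet> x \<le> t\<close> for two linear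
  functionals without a common zero direction. If one point of a candidate pair dominates the
  other in both functionals, then the pair is the closest pair in the quadrant with apex at the
  dominating point, so each point accounts for at most one such pair. Otherwise
  \<open>\<alpha> \<bullet> a \<le> \<alpha> \<bullet> b\<close> and \<open>\<beta> \<bullet> b \<le> \<beta> \<bullet> a\<close>, and \<open>\<bar>\<alpha> \<bullet> (b - a)\<bar>\<close> or \<open>\<bar>\<beta> \<bullet> (b - a)\<bar>\<close> is at least a
  fixed multiple of \<open>norm (b - a)\<close>; by symmetry say the first one. Fix \<open>a\<close> and order its partners
  \<open>b\<close> by \<open>\<alpha> \<bullet> b\<close>. The quadrants are then nested, so the distance to \<open>a\<close> decreases along this order.
  On the other hand it is bounded below by a multiple of \<open>\<alpha> \<bullet> (b - a)\<close>, which increases. Thus all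
  partners lie at distance comparable to that of the first one, they are separated by a
  comparable distance, and a packing argument bounds their number.
\<close>

section \<open>Packing and coercivity\<close>

text \<open>Cover the unit ball by finitely many balls of radius \<open>\<eta> / 2\<close>.
  Rescaling by \<open>a\<close> and \<open>R\<close> maps \<open>B\<close> injectively to the
  centres, since two points near one centre are closer than \<open>\<eta> * R\<close>. The cover
  depends on neither \<open>a\<close> nor \<open>R\<close>.\<close>

lemma packing_bound:
  fixes \<eta> :: real
  assumes "0 < \<eta>"
  obtains N where
    "\<And>(B::'a::euclidean_space set) a R. \<lbrakk>0 < R; B \<subseteq> cball a R;
       \<And>x y. \<lbrakk>x \<in> B; y \<in> B; x \<noteq> y\<rbrakk> \<Longrightarrow> \<eta> * R \<le> dist x y\<rbrakk> \<Longrightarrow> card B \<le> N"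
proof -
  have "\<exists>k. finite k \<and> k \<subseteq> cball (0::'a) 1 \<and> cball 0 1 \<subseteq> (\<Union>x\<in>k. ball x (\<eta> / 2))"
    by (rule seq_compact_imp_totally_bounded[rule_format])
      (use assms in \<open>auto simp flip: compact_eq_seq_compact_metric\<close>)
  then obtain k where k: "finite k" "cball (0::'a) 1 \<subseteq> (\<Union>x\<in>k. ball x (\<eta> / 2))"
    by blast
  show thesis
  proof (rule that[of "card k"])
    fix B :: "'a set" and a R
    assume R: "0 < R" and B: "B \<subseteq> cball a R"
      and sep: "\<And>x y. \<lbrakk>x \<in> B; y \<in> B; x \<noteq> y\<rbrakk> \<Longrightarrow> \<eta> * R \<le> dist x y"
    have "\<exists>c\<in>k. dist c ((x - a) /\<^sub>R R) < \<eta> / 2" if "x \<in> B" for x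
    proof -
      have "norm (x - a) \<le> R"
        using B that by (auto simp: dist_norm norm_minus_commute)
      moreover have "norm ((x - a) /\<^sub>R R) = norm (x - a) / R"
        using R by (simp add: divide_inverse mult.commute)
      ultimately have "(x - a) /\<^sub>R R \<in> cball 0 1"
        using R by simp
      then have "(x - a) /\<^sub>R R \<in> (\<Union>x\<in>k. ball x (\<eta> / 2))"
        using k(2) by (rule set_mp[rotated])
      then show ?thesis
        by auto
    qed
    then obtain g where g: "\<And>x. x \<in> B \<Longrightarrow> g x \<in> k \<and> dist (g x) ((x - a) /\<^sub>R R) < \<eta> / 2"
      by metis
    have "inj_on g B"
    proof (rule inj_onI, rule ccontr)
      fix x y assume xy: "x \<in> B" "y \<in> B" "g x = g y" "x \<noteq> y"
      have "dist ((x - a) /\<^sub>R R) ((y - a) /\<^sub>R R) = dist x y / R"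
        using R by (simp add: dist_norm flip: scaleR_diff_right)
          (simp add: field_simps)
      moreover have "dist ((x - a) /\<^sub>R R) ((y - a) /\<^sub>R R) < \<eta>"
        using g[OF xy(1)] g[OF xy(2)] xy(3)
          dist_triangle_half_r[of "g x" "(x - a) /\<^sub>R R" \<eta> "(y - a) /\<^sub>R R"] by simp
      ultimately have "dist x y < \<eta> * R"
        using R by (simp add: pos_divide_less_eq)
      then show False
        using sep[OF xy(1,2,4)] by simp
    qed
    then show "card B \<le> card k"
      using g k(1) by (intro card_inj_on_le[of g]) auto
  qed
qed

text \<open>The right-hand side is positively homogeneous and positive on the unit sphere, so its
  minimum there, attained by compactness, serves as \<open>c\<close>.\<close>

lemma inner_coercive:
  fixes \<alpha> \<beta> :: "'a::euclidean_space"
  assumes "\<And>x. \<lbrakk>\<alpha> \<bullet> x = 0; \<beta> \<bullet> x = 0\<rbrakk> \<Longrightarrow> x = 0"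
  obtains c where "0 < c" "\<And>x. c * norm x \<le> max \<bar>\<alpha> \<bullet> x\<bar> \<bar>\<beta> \<bullet> x\<bar>"
proof -
  define f where "f x = max \<bar>\<alpha> \<bullet> x\<bar> \<bar>\<beta> \<bullet> x\<bar>" for x
  have "continuous_on (sphere 0 1) f"
    unfolding f_def by (intro continuous_intros)
  then obtain z where z: "z \<in> sphere 0 1" "\<And>y. y \<in> sphere 0 1 \<Longrightarrow> f z \<le> f y"
    using continuous_attains_inf[of "sphere (0::'a) 1" f] by auto
  show thesis
  proof (rule that[of "f z"])
    have "z \<noteq> 0" using z(1) by auto
    then show "0 < f z"
      using assms[of z] by (auto simp: f_def less_max_iff_disj)
    fix x :: 'a
    show "f z * norm x \<le> max \<bar>\<alpha> \<bullet> x\<bar> \<bar>\<beta> \<bullet> x\<bar>"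
    proof (cases "x = 0")
      case False
      then have "f z \<le> f (x /\<^sub>R norm x)"
        by (intro z(2)) simp
      also have "\<dots> = f x / norm x"
        by (simp add: f_def abs_mult divide_inverse max_mult_distrib_left
            mult.commute[of _ "inverse (norm x)"])
      finally have "f z * norm x \<le> f x"
        using False by (simp add: pos_le_divide_eq)
      then show ?thesis
        by (simp only: f_def)
    qed simp
  qed
qed

section \<open>Wedges as quadrants\<close>

definition quadrant :: "'a::real_inner \<Rightarrow> 'a \<Rightarrow> real \<Rightarrow> real \<Rightarrow> 'a set" where
  "quadrant \<alpha> \<beta> s t = {x. \<alpha> \<bullet> x \<le> s \<and> \<beta> \<bullet> x \<le> t}"

lemma quadrant_commute: "quadrant \<alpha> \<beta> s t = quadrant \<beta> \<alpha> t s"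
  by (auto simp: quadrant_def)

lemma translate_quadrant:
  "(+) p ` quadrant \<alpha> \<beta> s t = quadrant \<alpha> \<beta> (s + \<alpha> \<bullet> p) (t + \<beta> \<bullet> p)"
  by (auto simp: quadrant_def inner_right_distrib inner_diff_right algebra_simps
      intro!: image_eqI[where x = "_ - p"])

lemma is_wedge_quadrant:
  assumes "is_wedge W"
  obtains \<alpha> \<beta> s t where "W = quadrant \<alpha> \<beta> s t"
    "\<And>x. \<lbrakk>\<alpha> \<bullet> x = 0; \<beta> \<bullet> x = 0\<rbrakk> \<Longrightarrow> x = 0"
proof -
  obtain \<alpha> \<beta> s t p d1 d2 \<theta> where W: "W = quadrant \<alpha> \<beta> s t"
    and fr: "frontier W = ray p d1 \<union> ray p d2"
    and d: "norm d1 = 1" "norm d2 = 1" "0 < \<theta>" "\<theta> < pi" "d1 \<bullet> d2 = cos \<theta>"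
    using assms unfolding is_wedge_def closed_halfplane_def quadrant_def
    by (auto simp: Collect_conj_eq)
  show thesis
  proof (rule that[OF W], rule ccontr)
    fix x assume x: "\<alpha> \<bullet> x = 0" "\<beta> \<bullet> x = 0" "x \<noteq> 0"
    \<comment> \<open>Then \<open>W\<close> and its frontier are invariant under translation along \<open>x\<close>, so both \<open>x\<close> and \<open>- x\<close>
      point along the boundary rays.\<close>
    have inv: "(+) y ` W = W" if "y = x \<or> y = - x" for y
      using that x by (auto simp: W translate_quadrant)
    have p: "p \<in> frontier W"
      unfolding fr ray_def by (auto intro!: exI[of _ 0])
    have on_ray: "\<exists>t\<ge>0. y = t *\<^sub>R d1 \<or> y = t *\<^sub>R d2" if "y = x \<or> y = - x" for y
    proof -
      have "y + p \<in> frontier W"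
        using p frontier_translation[of y W] inv[OF that] by auto
      then show ?thesis
        unfolding fr ray_def by (auto simp: add.commute)
    qed
    obtain t t' where t: "t \<ge> 0" "x = t *\<^sub>R d1 \<or> x = t *\<^sub>R d2"
      and t': "t' \<ge> 0" "- x = t' *\<^sub>R d1 \<or> - x = t' *\<^sub>R d2"
      using on_ray[of x] on_ray[of "- x"] by auto
    have "norm x = t"
      using t d by auto
    moreover have "norm (- x) = t'"
      using t' d by (metis abs_of_nonneg mult.right_neutral norm_scaleR)
    ultimately have pos: "t > 0" "t' = t" using x(3) by auto
    have opposite: "t *\<^sub>R (d + d') = 0" if "x = t *\<^sub>R d" "- x = t *\<^sub>R d'" for d d'
      by (simp only: scaleR_add_right that[symmetric] add.right_inverse)
    have "d1 \<noteq> 0" "d2 \<noteq> 0" using d by auto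
    then have "d1 + d1 \<noteq> 0" "d2 + d2 \<noteq> 0"
      by (metis scaleR_2 scaleR_eq_0_iff zero_neq_numeral)+
    \<comment> \<open>If \<open>x\<close> and \<open>- x\<close> pointed along the same ray, twice
      its unit direction would vanish. So the two rays are opposite, contradicting an angle below
      \<open>pi\<close>.\<close>
    moreover have "t *\<^sub>R (d1 + d2) = 0 \<or> t *\<^sub>R (d1 + d1) = 0 \<or> t *\<^sub>R (d2 + d2) = 0"
      using t(2) t'(2)[unfolded pos(2)] opposite opposite[of d2 d1, unfolded add.commute[of d2 d1]]
      by blast
    ultimately have "d1 + d2 = 0"
      using pos(1) by (metis less_irrefl scaleR_eq_0_iff)
    then have "d2 = - d1" by (simp add: add_eq_0_iff)
    then have "d1 \<bullet> d2 = - 1"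
      using d(1) by (simp add: dot_square_norm)
    then have "cos \<theta> = cos pi"
      using d(5) by simp
    then show False
      using cos_monotone_0_pi[of \<theta> pi] d by simp
  qed
qed

lemma closest_pair_doubleton:
  "closest_pair T {a, b} \<longleftrightarrow>
    a \<in> T \<and> b \<in> T \<and> a \<noteq> b \<and> (\<forall>c\<in>T. \<forall>d\<in>T. c \<noteq> d \<longrightarrow> dist a b \<le> dist c d)"
  unfolding closest_pair_def by (auto simp: doubleton_eq_iff dist_commute)

lemma closest_pair_subset:
  assumes "closest_pair T {a, b}" "T' \<subseteq> T" "a \<in> T'" "b \<in> T'"
  shows "closest_pair T' {a, b}"
  using assms unfolding closest_pair_doubleton by blast

lemma closest_pair_unique:
  assumes "distinct_distances S" "T \<subseteq> S" "closest_pair T e" "closest_pair T e'"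
  shows "e = e'"
proof -
  obtain a b where e: "e = {a, b}" using assms(3) unfolding closest_pair_def by blast
  obtain c d where e': "e' = {c, d}" using assms(4) unfolding closest_pair_def by blast
  have "dist a b = dist c d" "a \<noteq> b" "c \<noteq> d" "{a, b, c, d} \<subseteq> S"
    using assms(2-4) unfolding e e' closest_pair_doubleton by (auto intro: antisym)
  then show ?thesis
    using assms(1) unfolding e e' distinct_distances_def by blast
qed

section \<open>Charging candidate pairs to points\<close>

text \<open>The quadrant is the smallest one containing both points when \<open>b\<close> is the
  larger in \<alpha> and \<open>a\<close> in \<beta>. This order fixes the sign, so coercivity needs
  no absolute value.\<close>

definition partners :: "real ^ 2 \<Rightarrow> real ^ 2 \<Rightarrow> real \<Rightarrow> (real ^ 2) set \<Rightarrow> real ^ 2 \<Rightarrow> (real ^ 2) set" where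
  "partners \<alpha> \<beta> c S a =
    {b. closest_pair (S \<inter> quadrant \<alpha> \<beta> (\<alpha> \<bullet> b) (\<beta> \<bullet> a)) {a, b} \<and> c * norm (b - a) \<le> \<alpha> \<bullet> (b - a)}"

definition dominated_pairs :: "real ^ 2 \<Rightarrow> real ^ 2 \<Rightarrow> (real ^ 2) set \<Rightarrow> real ^ 2 \<Rightarrow> (real ^ 2) set set" where
  "dominated_pairs \<alpha> \<beta> S a = {e. closest_pair (S \<inter> quadrant \<alpha> \<beta> (\<alpha> \<bullet> a) (\<beta> \<bullet> a)) e}"

lemma card_dominated_pairs:
  assumes "distinct_distances S"
  shows "card (dominated_pairs \<alpha> \<beta> S a) \<le> 1"
proof -
  have "e = e'" if "e \<in> dominated_pairs \<alpha> \<beta> S a" "e' \<in> dominated_pairs \<alpha> \<beta> S a" for e e'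
    using closest_pair_unique[OF assms Int_lower1] that unfolding dominated_pairs_def by blast
  then have "dominated_pairs \<alpha> \<beta> S a = {} \<or> (\<exists>e. dominated_pairs \<alpha> \<beta> S a = {e})"
    by blast
  then show ?thesis by auto
qed

text \<open>The quadrant of \<open>b'\<close> has the same \<beta>-threshold and a larger
  \<alpha>-threshold, so it also contains \<open>b\<close>, and \<open>{a, b'}\<close> is closest
  there.\<close>

lemma partners_nested:
  assumes "b \<in> partners \<alpha> \<beta> c S a" "b' \<in> partners \<alpha> \<beta> c S a" "\<alpha> \<bullet> b \<le> \<alpha> \<bullet> b'"
  shows "dist a b' \<le> dist a b" "b \<noteq> b' \<Longrightarrow> dist a b' \<le> dist b b'"
proof -
  have "a \<noteq> b" "b \<in> S \<inter> quadrant \<alpha> \<beta> (\<alpha> \<bullet> b') (\<beta> \<bullet> a)"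
    using assms(1,3) unfolding partners_def closest_pair_doubleton quadrant_def by auto
  then show "dist a b' \<le> dist a b" "b \<noteq> b' \<Longrightarrow> dist a b' \<le> dist b b'"
    using assms(2) unfolding partners_def closest_pair_doubleton by blast+
qed

lemma card_partners_bound:
  assumes "0 < c"
  obtains N where "\<And>S a. finite S \<Longrightarrow> card (partners \<alpha> \<beta> c S a) \<le> N"
proof -
  \<comment> \<open>The ratio of the coercivity constant to the Cauchy-Schwarz constant; the summand
    1 avoids division by zero.\<close>
  define \<eta> where "\<eta> = c / (norm \<alpha> + 1)"
  have pos: "0 < norm \<alpha> + 1"
    by (simp add: add_nonneg_pos)
  have "\<eta> > 0" using assms pos by (simp add: \<eta>_def)
  then obtain N where N: "\<And>(B::(real^2) set) a R. \<lbrakk>0 < R; B \<subseteq> cball a R;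
       \<And>x y. \<lbrakk>x \<in> B; y \<in> B; x \<noteq> y\<rbrakk> \<Longrightarrow> \<eta> * R \<le> dist x y\<rbrakk> \<Longrightarrow> card B \<le> N"
    using packing_bound[of \<eta>, where ?'a = "real^2"] by metis
  have "card (partners \<alpha> \<beta> c S a) \<le> N" if "finite S" for S a
  proof (cases "partners \<alpha> \<beta> c S a = {}")
    case False
    define B where "B = partners \<alpha> \<beta> c S a"
    have "B \<subseteq> S" unfolding B_def partners_def closest_pair_doubleton by auto
    then have "finite B" using that finite_subset by blast
    \<comment> \<open>The partner with least \<alpha>-value is the farthest from \<open>a\<close>,
      so its distance is the packing radius.\<close>
    then obtain b0 where b0: "b0 \<in> B" "\<And>b. b \<in> B \<Longrightarrow> \<alpha> \<bullet> b0 \<le> \<alpha> \<bullet> b"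
      using False arg_min_if_finite[of B "\<lambda>b. \<alpha> \<bullet> b"] B_def
      by (metis not_less)
    define R where "R = dist a b0"
    have "a \<noteq> b0" using b0(1) unfolding B_def partners_def closest_pair_doubleton by auto
    then have R: "0 < R" by (simp add: R_def)
    have far: "\<eta> * R \<le> dist a b" if "b \<in> B" for b
    proof -
      have "c * R \<le> \<alpha> \<bullet> (b0 - a)"
        using b0(1) by (simp add: B_def partners_def R_def dist_norm norm_minus_commute)
      also have "\<dots> \<le> \<alpha> \<bullet> (b - a)"
        using b0(2)[OF that] by (simp add: inner_diff_right)
      also have "\<dots> \<le> norm \<alpha> * norm (b - a)"
        by (rule norm_cauchy_schwarz)
      also have "\<dots> \<le> (norm \<alpha> + 1) * dist a b"
        by (simp add: dist_norm norm_minus_commute mult_right_mono)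
      finally show ?thesis
        using pos by (simp add: \<eta>_def field_simps)
    qed
    \<comment> \<open>Nestedness gives \<open>dist x y\<close> at least \<open>dist a y\<close>,
      which \<open>far\<close> bounds below.\<close>
    have sep: "\<eta> * R \<le> dist x y" if "x \<in> B" "y \<in> B" "x \<noteq> y" "\<alpha> \<bullet> x \<le> \<alpha> \<bullet> y" for x y
      using partners_nested(2)[of x \<alpha> \<beta> c S a y] that far[OF that(2)] by (auto simp: B_def)
    have "card B \<le> N"
    proof (rule N[OF R])
      show "B \<subseteq> cball a R"
        using b0 partners_nested(1) by (auto simp: B_def R_def)
      show "\<eta> * R \<le> dist x y" if "x \<in> B" "y \<in> B" "x \<noteq> y" for x y
        using sep[of x y] sep[of y x] that by (metis dist_commute linear)
    qed
    then show ?thesis by (simp add: B_def)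
  qed simp
  then show thesis by (rule that)
qed

text \<open>A closest pair stays closest in the smallest quadrant containing it. Charge it to the
  point that is larger in \<beta>, once the two are ordered by \<alpha>.\<close>

lemma closest_pair_charge:
  assumes "closest_pair (S \<inter> quadrant \<alpha> \<beta> s t) {a, b}" "c * norm (b - a) \<le> \<bar>\<alpha> \<bullet> (b - a)\<bar>"
  shows "\<exists>x\<in>S. {a, b} \<in> dominated_pairs \<alpha> \<beta> S x \<union> (\<lambda>y. {x, y}) ` partners \<alpha> \<beta> c S x"
proof -
  have *: "\<exists>x\<in>S. {a, b} \<in> dominated_pairs \<alpha> \<beta> S x \<union> (\<lambda>y. {x, y}) ` partners \<alpha> \<beta> c S x"
    if le: "\<alpha> \<bullet> a \<le> \<alpha> \<bullet> b" and cp: "closest_pair (S \<inter> quadrant \<alpha> \<beta> s t) {a, b}"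
      and coercive: "c * norm (b - a) \<le> \<bar>\<alpha> \<bullet> (b - a)\<bar>" for a b
  proof -
    have ab: "a \<in> S" "b \<in> S" "\<alpha> \<bullet> b \<le> s" "\<beta> \<bullet> a \<le> t" "\<beta> \<bullet> b \<le> t"
      using cp by (auto simp: closest_pair_doubleton quadrant_def)
    show ?thesis
    proof (cases "\<beta> \<bullet> a \<le> \<beta> \<bullet> b")
      case True
      then have "closest_pair (S \<inter> quadrant \<alpha> \<beta> (\<alpha> \<bullet> b) (\<beta> \<bullet> b)) {a, b}"
        using ab le by (intro closest_pair_subset[OF cp]) (auto simp: quadrant_def)
      then show ?thesis
        using ab by (auto simp: dominated_pairs_def)
    next
      case False
      then have "closest_pair (S \<inter> quadrant \<alpha> \<beta> (\<alpha> \<bullet> b) (\<beta> \<bullet> a)) {a, b}"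
        using ab le by (intro closest_pair_subset[OF cp]) (auto simp: quadrant_def)
      then have "b \<in> partners \<alpha> \<beta> c S a"
        using le coercive by (simp add: partners_def inner_diff_right)
      then show ?thesis
        using ab by blast
    qed
  qed
  have "c * norm (a - b) \<le> \<bar>\<alpha> \<bullet> (a - b)\<bar>"
    using assms(2) by (simp add: norm_minus_commute inner_diff_right abs_minus_commute)
  moreover have "{b, a} = {a, b}" by blast
  ultimately show ?thesis
    using *[OF _ assms] *[of b a] assms(1) by (cases "\<alpha> \<bullet> a \<le> \<alpha> \<bullet> b") simp_all
qed

theorem lemma2p10:
  fixes W :: "(real ^ 2) set"
  assumes "is_wedge W"
  shows "\<exists>C::real. \<forall>(n::nat) S. finite S \<and> card S = n \<and> distinct_distances S \<longrightarrow>
           real (card (candidate_pairs S (translates W))) \<le> C * real n"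
proof -
  obtain \<alpha> \<beta> s t where W: "W = quadrant \<alpha> \<beta> s t"
    and indep: "\<And>x. \<lbrakk>\<alpha> \<bullet> x = 0; \<beta> \<bullet> x = 0\<rbrakk> \<Longrightarrow> x = 0"
    using is_wedge_quadrant[OF assms] by metis
  obtain c where c: "0 < c" "\<And>x. c * norm x \<le> max \<bar>\<alpha> \<bullet> x\<bar> \<bar>\<beta> \<bullet> x\<bar>"
    using inner_coercive[OF indep] by metis
  obtain N where N: "\<And>S a. finite S \<Longrightarrow> card (partners \<alpha> \<beta> c S a) \<le> N"
    using card_partners_bound[OF c(1)] by metis
  obtain N' where N': "\<And>S a. finite S \<Longrightarrow> card (partners \<beta> \<alpha> c S a) \<le> N'"
    using card_partners_bound[OF c(1)] by metis
  \<comment> \<open>Each point is charged for at most one dominated pair, \<open>N\<close> partners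
    along \<alpha> and \<open>N'\<close> along \<beta>.\<close>
  have "real (card (candidate_pairs S (translates W))) \<le> real (1 + N + N') * real (card S)"
    if S: "finite S" "distinct_distances S" for S
  proof -
    define F where "F x = dominated_pairs \<alpha> \<beta> S x \<union> (\<lambda>y. {x, y}) ` partners \<alpha> \<beta> c S x
      \<union> (\<lambda>y. {x, y}) ` partners \<beta> \<alpha> c S x" for x
    have fin_partners: "finite (partners \<alpha>' \<beta>' c S x)" for \<alpha>' \<beta>' x
      by (rule finite_subset[OF _ S(1)]) (auto simp: partners_def closest_pair_doubleton)
    have fin: "finite (F x)" for x
    proof -
      have "dominated_pairs \<alpha> \<beta> S x \<subseteq> Pow S"
        by (auto simp: dominated_pairs_def closest_pair_def)
      then have "finite (dominated_pairs \<alpha> \<beta> S x)"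
        using S(1) finite_subset by blast
      then show ?thesis
        by (simp add: F_def fin_partners)
    qed
    have card_F: "card (F x) \<le> 1 + N + N'" for x
      unfolding F_def
      by (intro order_trans[OF card_Un_le] add_mono card_dominated_pairs S(2)
          order_trans[OF card_image_le[OF fin_partners]] N N' S(1))
    have "candidate_pairs S (translates W) \<subseteq> (\<Union>x\<in>S. F x)"
    proof
      fix e assume "e \<in> candidate_pairs S (translates W)"
      then obtain s' t' where e: "closest_pair (S \<inter> quadrant \<alpha> \<beta> s' t') e"
        by (auto simp: candidate_pairs_def translates_def W translate_quadrant)
      then obtain a b where ab: "e = {a, b}"
        by (auto simp: closest_pair_def)
      \<comment> \<open>The second case exchanges the functionals; by symmetry its dominated pairs
        are already counted in \<open>F\<close>.\<close>
      have swap: "dominated_pairs \<beta> \<alpha> S x = dominated_pairs \<alpha> \<beta> S x" for x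
        by (simp add: dominated_pairs_def quadrant_commute[of \<beta> \<alpha>])
      consider "c * norm (b - a) \<le> \<bar>\<alpha> \<bullet> (b - a)\<bar>" | "c * norm (b - a) \<le> \<bar>\<beta> \<bullet> (b - a)\<bar>"
        using c(2)[of "b - a"] by (auto simp: le_max_iff_disj)
      then show "e \<in> (\<Union>x\<in>S. F x)"
      proof cases
        case 1
        then show ?thesis
          using closest_pair_charge[of S \<alpha> \<beta> s' t' a b c] e unfolding ab F_def by blast
      next
        case 2
        then show ?thesis
          using closest_pair_charge[of S \<beta> \<alpha> t' s' a b c] e
          unfolding ab F_def swap quadrant_commute[of \<beta> \<alpha> t' s'] by blast
      qed
    qed
    then have "card (candidate_pairs S (translates W)) \<le> card (\<Union>x\<in>S. F x)"
      by (intro card_mono) (simp_all add: S fin)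
    also have "\<dots> \<le> (\<Sum>x\<in>S. card (F x))"
      by (rule card_UN_le[OF S(1)])
    also have "\<dots> \<le> (1 + N + N') * card S"
      using sum_bounded_above[of S "\<lambda>x. card (F x)" "1 + N + N'"] card_F by (simp add: mult.commute)
    finally show ?thesis
      by (metis of_nat_le_iff of_nat_mult)
  qed
  then show ?thesis by blast
qed

end
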